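(* Fix real numbers $c<d$. The spaces $\mathrm{(pfd)}$, $\mathrm{(fid)}$, $\mathrm{(ffid)}$ and $\mathrm{(ffid^{[c,d]})}$, with the interleaving distance, are not complete.
   Context: Fix a field $\mathbf{k}$. A persistence module is a functor $M:(\mathbb{R},\le)\to \mathrm{Vect}_{\mathbf{k}}$; "persistence module" means isomorphism class. For an interval $J\subset\mathbb{R}$, the interval module $J$ is $\mathbf{k}$ at points of $J$ and $0$ elsewhere, with identity maps between points of $J$ and zero maps otherwise. For $\varepsilon\ge 0$, $M,N$ are $\varepsilon$-interleaved if there are families of linear maps $\varphi_a:M(a)\to N(a+\varepsilon)$ and $\psi_a:N(a)\to M(a+\varepsilon)$, natural in $a\in\mathbb{R}$, with $\psi_{a+\varepsilon}\varphi_a=M(a\le a+2\varepsilon)$ and $\varphi_{a+\varepsilon}\psi_a=N(a\le a+2\varepsilon)$ for all $a$. The interleaving distance is $d_I(M,N)=\inf\{\varepsilon\ge0 : M,N \text{ are } \varepsilon\text{-interleaved}\}$ ($\infty$ if there is none). It is an extended pseudometric. Sets of persistence modules: $\mathrm{(pfd)}$: persistence modules $M$ with every $M(a)$ finite dimensional; $\mathrm{(fid)}$: finite direct sums of interval modules (including the zero module); $\mathrm{(ffid)}$: those in $\mathrm{(fid)}$ with all intervals finite (bounded); $\mathrm{(ffid^{[c,d]})}$: those in $\mathrm{(ffid)}$ with all intervals contained in $[c,d]$. An extended pseudometric space $(X,\rho)$ is complete if every Cauchy sequence $(x_n)$ converges to some $x\in X$, i.e. $\rho(x_n,x)\to 0$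 (limits need not be unique). *)

theory Defs
  imports "HOL-Analysis.Analysis" "Jordan_Normal_Form.Missing_VectorSpace"
begin

text \<open>A family of \<open>K\<close>-vector spaces indexed by the reals, with a transition function
  \<open>trans_map M a b\<close> from the space at \<open>a\<close> to the space at \<open>b\<close>. The values of \<open>trans_map M a b\<close>
  outside the carrier, or for \<open>a > b\<close>, carry no information.\<close>

record ('k, 'v) pmod =
  space_at :: "real \<Rightarrow> ('k, 'v) module"
  trans_map :: "real \<Rightarrow> real \<Rightarrow> 'v \<Rightarrow> 'v"

definition persistence_module :: "('k, 'r) ring_scheme \<Rightarrow> ('k, 'v) pmod \<Rightarrow> bool" where
  "persistence_module K M \<longleftrightarrow>
     (\<forall>a. vectorspace K (space_at M a)) \<and>
     (\<forall>a b. a \<le> b \<longrightarrow> linear_map K (space_at M a) (space_at M b) (trans_map M a b)) \<and>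
     (\<forall>a. \<forall>x \<in> carrier (space_at M a). trans_map M a a x = x) \<and>
     (\<forall>a b c. a \<le> b \<longrightarrow> b \<le> c \<longrightarrow>
        (\<forall>x \<in> carrier (space_at M a). trans_map M b c (trans_map M a b x) = trans_map M a c x))"

text \<open>The two modules may have vectors of different types; this is used to compare a module
  with a direct sum of interval modules.\<close>

definition pmod_iso :: "('k, 'r) ring_scheme \<Rightarrow> ('k, 'v) pmod \<Rightarrow> ('k, 'w) pmod \<Rightarrow> bool" where
  "pmod_iso K M N \<longleftrightarrow> (\<exists>\<theta>.
     (\<forall>a. linear_map K (space_at M a) (space_at N a) (\<theta> a) \<and>
          bij_betw (\<theta> a) (carrier (space_at M a)) (carrier (space_at N a))) \<and>
     (\<forall>a b. a \<le> b \<longrightarrow>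
        (\<forall>x \<in> carrier (space_at M a). \<theta> b (trans_map M a b x) = trans_map N a b (\<theta> a x))))"

definition interleaved ::
  "('k, 'r) ring_scheme \<Rightarrow> real \<Rightarrow> ('k, 'v) pmod \<Rightarrow> ('k, 'w) pmod \<Rightarrow> bool" where
  "interleaved K \<epsilon> M N \<longleftrightarrow> (\<exists>\<phi> \<psi>.
     (\<forall>a. linear_map K (space_at M a) (space_at N (a + \<epsilon>)) (\<phi> a)) \<and>
     (\<forall>a. linear_map K (space_at N a) (space_at M (a + \<epsilon>)) (\<psi> a)) \<and>
     (\<forall>a b. a \<le> b \<longrightarrow> (\<forall>x \<in> carrier (space_at M a).
        \<phi> b (trans_map M a b x) = trans_map N (a + \<epsilon>) (b + \<epsilon>) (\<phi> a x))) \<and>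
     (\<forall>a b. a \<le> b \<longrightarrow> (\<forall>y \<in> carrier (space_at N a).
        \<psi> b (trans_map N a b y) = trans_map M (a + \<epsilon>) (b + \<epsilon>) (\<psi> a y))) \<and>
     (\<forall>a. \<forall>x \<in> carrier (space_at M a). \<psi> (a + \<epsilon>) (\<phi> a x) = trans_map M a (a + 2 * \<epsilon>) x) \<and>
     (\<forall>a. \<forall>y \<in> carrier (space_at N a). \<phi> (a + \<epsilon>) (\<psi> a y) = trans_map N a (a + 2 * \<epsilon>) y))"

definition interleaving_dist ::
  "('k, 'r) ring_scheme \<Rightarrow> ('k, 'v) pmod \<Rightarrow> ('k, 'w) pmod \<Rightarrow> ennreal" where
  "interleaving_dist K M N = (INF \<epsilon> \<in> {\<epsilon>. 0 \<le> \<epsilon> \<and> interleaved K \<epsilon> M N}. ennreal \<epsilon>)"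

text \<open>Interval modules and their finite direct sums. The library fields \<open>mult\<close> and \<open>one\<close> of a
  module record are not part of the vector space structure.\<close>

definition line_space :: "('k, 'r) ring_scheme \<Rightarrow> ('k, 'k) module" where
  "line_space K = \<lparr>carrier = carrier K, mult = mult K, one = \<one>\<^bsub>K\<^esub>,
     zero = \<zero>\<^bsub>K\<^esub>, add = add K, smult = mult K\<rparr>"

definition zero_space :: "('k, 'r) ring_scheme \<Rightarrow> ('k, 'k) module" where
  "zero_space K = (line_space K)\<lparr>carrier := {\<zero>\<^bsub>K\<^esub>}\<rparr>"

definition interval_module :: "('k, 'r) ring_scheme \<Rightarrow> real set \<Rightarrow> ('k, 'k) pmod" where
  "interval_module K J =
     \<lparr>space_at = (\<lambda>a. if a \<in> J then line_space K else zero_space K),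
      trans_map = (\<lambda>a b x. if a \<in> J \<and> b \<in> J then x else \<zero>\<^bsub>K\<^esub>)\<rparr>"

definition dsum_space :: "'i set \<Rightarrow> ('i \<Rightarrow> ('k, 'v) module) \<Rightarrow> ('k, 'i \<Rightarrow> 'v) module" where
  "dsum_space I V =
     \<lparr>carrier = (\<Pi>\<^sub>E i\<in>I. carrier (V i)),
      mult = (\<lambda>f g. \<lambda>i\<in>I. \<zero>\<^bsub>V i\<^esub>),
      one = (\<lambda>i\<in>I. \<zero>\<^bsub>V i\<^esub>),
      zero = (\<lambda>i\<in>I. \<zero>\<^bsub>V i\<^esub>),
      add = (\<lambda>f g. \<lambda>i\<in>I. f i \<oplus>\<^bsub>V i\<^esub> g i),
      smult = (\<lambda>c f. \<lambda>i\<in>I. c \<odot>\<^bsub>V i\<^esub> f i)\<rparr>"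

text \<open>The space of all families is the direct sum because \<open>I\<close> is finite wherever this is used;
  for \<open>I = {}\<close> it is the zero module.\<close>

definition pmod_dsum :: "'i set \<Rightarrow> ('i \<Rightarrow> ('k, 'v) pmod) \<Rightarrow> ('k, 'i \<Rightarrow> 'v) pmod" where
  "pmod_dsum I M =
     \<lparr>space_at = (\<lambda>a. dsum_space I (\<lambda>i. space_at (M i) a)),
      trans_map = (\<lambda>a b f. \<lambda>i\<in>I. trans_map (M i) a b (f i))\<rparr>"

definition interval_sum :: "('k, 'r) ring_scheme \<Rightarrow> (real set \<Rightarrow> bool) \<Rightarrow> ('k, 'v) pmod \<Rightarrow> bool" where
  "interval_sum K P M \<longleftrightarrow> (\<exists>(n :: nat) J.
     (\<forall>i < n. is_interval (J i) \<and> P (J i)) \<and>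
     pmod_iso K M (pmod_dsum {..<n} (\<lambda>i. interval_module K (J i))))"

definition iso_class :: "('k, 'r) ring_scheme \<Rightarrow> ('k, 'v) pmod \<Rightarrow> ('k, 'v) pmod set" where
  "iso_class K M = {N. persistence_module K N \<and> pmod_iso K M N}"

text \<open>The interleaving distance is invariant under isomorphism, so the following infimum over
  representatives is the common value of \<^const>\<open>interleaving_dist\<close>; see
  \<open>class_dist_iso_class\<close> below.\<close>

definition class_dist ::
  "('k, 'r) ring_scheme \<Rightarrow> ('k, 'v) pmod set \<Rightarrow> ('k, 'v) pmod set \<Rightarrow> ennreal" where
  "class_dist K X Y = (INF M \<in> X. INF N \<in> Y. interleaving_dist K M N)"

text \<open>The sets of isomorphism classes (pfd), (fid), (ffid) and (ffid) on \<open>[c, d]\<close>, for modules whose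
  vectors are elements of the type \<open>'v\<close>. They contain a representative of every such module as soon
  as \<open>'v\<close> is large enough to hold a copy of each power \<open>K^n\<close>; for a small type such as \<open>unit\<close>
  they degenerate.\<close>

definition pfd :: "('k, 'r) ring_scheme \<Rightarrow> ('k, 'v) pmod set set" where
  "pfd K = {iso_class K M | M. persistence_module K M \<and>
     (\<forall>a. vectorspace.fin_dim K (space_at M a))}"

definition fid :: "('k, 'r) ring_scheme \<Rightarrow> ('k, 'v) pmod set set" where
  "fid K = {iso_class K M | M. persistence_module K M \<and> interval_sum K (\<lambda>J. True) M}"

definition ffid :: "('k, 'r) ring_scheme \<Rightarrow> ('k, 'v) pmod set set" where
  "ffid K = {iso_class K M | M. persistence_module K M \<and> interval_sum K bounded M}"

definition ffid_on :: "('k, 'r) ring_scheme \<Rightarrow> real \<Rightarrow> real \<Rightarrow> ('k, 'v) pmod set set" where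
  "ffid_on K c d = {iso_class K M | M. persistence_module K M \<and>
     interval_sum K (\<lambda>J. bounded J \<and> J \<subseteq> {c..d}) M}"

definition ext_Cauchy :: "('x \<Rightarrow> 'x \<Rightarrow> ennreal) \<Rightarrow> (nat \<Rightarrow> 'x) \<Rightarrow> bool" where
  "ext_Cauchy \<rho> x \<longleftrightarrow> (\<forall>e > 0. \<exists>N. \<forall>m \<ge> N. \<forall>n \<ge> N. \<rho> (x m) (x n) < e)"

definition ext_complete :: "'x set \<Rightarrow> ('x \<Rightarrow> 'x \<Rightarrow> ennreal) \<Rightarrow> bool" where
  "ext_complete X \<rho> \<longleftrightarrow> (\<forall>x. range x \<subseteq> X \<longrightarrow> ext_Cauchy \<rho> x \<longrightarrow>
     (\<exists>y \<in> X. (\<lambda>n. \<rho> (x n) y) \<longlonglongrightarrow> 0))"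

lemma linear_map_iff:
  "linear_map K V W f \<longleftrightarrow> vectorspace K V \<and> vectorspace K W \<and> f \<in> module_hom K V W"
  by (auto simp: linear_map_def mod_hom_def mod_hom_axioms_def vectorspace_def)

lemma linear_map_compose:
  assumes "linear_map K U V f" "linear_map K V W g"
  shows "linear_map K U W (\<lambda>x. g (f x))"
  using assms by (auto simp: linear_map_iff module_hom_def Pi_iff)

lemma linear_map_closed: "linear_map K V W f \<Longrightarrow> x \<in> carrier V \<Longrightarrow> f x \<in> carrier W"
  by (auto simp: linear_map_iff module_hom_def)

lemma linear_map_inv_into:
  assumes f: "linear_map K V W f" and b: "bij_betw f (carrier V) (carrier W)"
  shows "linear_map K W V (inv_into (carrier V) f)"
proof -
  let ?g = "inv_into (carrier V) f"
  interpret V: vectorspace K V using f by (simp add: linear_map_iff)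
  interpret W: vectorspace K W using f by (simp add: linear_map_iff)
  have g: "?g y \<in> carrier V" "f (?g y) = y" if "y \<in> carrier W" for y
    using b that by (auto simp: bij_betw_def intro: inv_into_into f_inv_into_f)
  have h: "?g (f x) = x" if "x \<in> carrier V" for x
    using b that by (auto simp: bij_betw_def)
  have "?g \<in> module_hom K W V"
    unfolding module_hom_def
  proof (intro CollectI conjI allI impI)
    show "?g \<in> carrier W \<rightarrow> carrier V" using g by auto
  next
    fix x y assume xy: "x \<in> carrier W \<and> y \<in> carrier W"
    then have "f (?g x \<oplus>\<^bsub>V\<^esub> ?g y) = x \<oplus>\<^bsub>W\<^esub> y"
      using f g by (auto simp: linear_map_iff module_hom_def)
    then show "?g (x \<oplus>\<^bsub>W\<^esub> y) = ?g x \<oplus>\<^bsub>V\<^esub> ?g y"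
      using h[of "?g x \<oplus>\<^bsub>V\<^esub> ?g y"] g xy by auto
  next
    fix r x assume rx: "r \<in> carrier K \<and> x \<in> carrier W"
    then have "f (r \<odot>\<^bsub>V\<^esub> ?g x) = r \<odot>\<^bsub>W\<^esub> x"
      using f g by (auto simp: linear_map_iff module_hom_def)
    then show "?g (r \<odot>\<^bsub>W\<^esub> x) = r \<odot>\<^bsub>V\<^esub> ?g x"
      using h[of "r \<odot>\<^bsub>V\<^esub> ?g x"] g rx by auto
  qed
  then show ?thesis using f by (simp add: linear_map_iff)
qed

lemma persistence_moduleD:
  assumes "persistence_module K M"
  shows "vectorspace K (space_at M a)"
    "a \<le> b \<Longrightarrow> linear_map K (space_at M a) (space_at M b) (trans_map M a b)"
    "x \<in> carrier (space_at M a) \<Longrightarrow> trans_map M a a x = x"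
    "a \<le> b \<Longrightarrow> b \<le> c \<Longrightarrow> x \<in> carrier (space_at M a) \<Longrightarrow>
       trans_map M b c (trans_map M a b x) = trans_map M a c x"
    "a \<le> b \<Longrightarrow> x \<in> carrier (space_at M a) \<Longrightarrow> trans_map M a b x \<in> carrier (space_at M b)"
  using assms by (auto simp: persistence_module_def intro: linear_map_closed)

lemma pmod_isoE:
  assumes "persistence_module K M" "persistence_module K N" "pmod_iso K M N"
  obtains \<theta> \<eta> where
    "\<And>a. linear_map K (space_at M a) (space_at N a) (\<theta> a)"
    "\<And>a. linear_map K (space_at N a) (space_at M a) (\<eta> a)"
    "\<And>a x. x \<in> carrier (space_at M a) \<Longrightarrow> \<eta> a (\<theta> a x) = x"
    "\<And>a y. y \<in> carrier (space_at N a) \<Longrightarrow> \<theta> a (\<eta> a y) = y"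
    "\<And>a b x. a \<le> b \<Longrightarrow> x \<in> carrier (space_at M a) \<Longrightarrow>
       \<theta> b (trans_map M a b x) = trans_map N a b (\<theta> a x)"
    "\<And>a b y. a \<le> b \<Longrightarrow> y \<in> carrier (space_at N a) \<Longrightarrow>
       \<eta> b (trans_map N a b y) = trans_map M a b (\<eta> a y)"
proof -
  obtain \<theta> where lin: "\<And>a. linear_map K (space_at M a) (space_at N a) (\<theta> a)"
    and bij: "\<And>a. bij_betw (\<theta> a) (carrier (space_at M a)) (carrier (space_at N a))"
    and nat: "\<And>a b x. a \<le> b \<Longrightarrow> x \<in> carrier (space_at M a) \<Longrightarrow>
       \<theta> b (trans_map M a b x) = trans_map N a b (\<theta> a x)"
    using assms(3) unfolding pmod_iso_def by blast
  define \<eta> where "\<eta> a = inv_into (carrier (space_at M a)) (\<theta> a)" for a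
  have lin': "linear_map K (space_at N a) (space_at M a) (\<eta> a)" for a
    unfolding \<eta>_def by (rule linear_map_inv_into[OF lin bij])
  have l: "\<eta> a (\<theta> a x) = x" if "x \<in> carrier (space_at M a)" for a x
    using bij[of a] that by (auto simp: \<eta>_def bij_betw_def)
  have r: "\<theta> a (\<eta> a y) = y" if "y \<in> carrier (space_at N a)" for a y
    using bij[of a] that by (auto simp: \<eta>_def bij_betw_def intro: f_inv_into_f)
  have "\<eta> b (trans_map N a b y) = trans_map M a b (\<eta> a y)"
    if "a \<le> b" "y \<in> carrier (space_at N a)" for a b y
  proof -
    have y: "\<eta> a y \<in> carrier (space_at M a)" using linear_map_closed[OF lin' that(2)] .
    have "\<theta> b (trans_map M a b (\<eta> a y)) = trans_map N a b y"
      using nat[OF that(1) y] r that(2) by simp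
    then show ?thesis
      using l[OF persistence_moduleD(5)[OF assms(1) that(1) y]] by simp
  qed
  then show thesis using that lin lin' l r nat by blast
qed

lemma interleaved_pmod_iso:
  assumes M: "persistence_module K M" "persistence_module K M'" "pmod_iso K M M'"
    and N: "persistence_module K N" "persistence_module K N'" "pmod_iso K N N'"
    and e: "0 \<le> \<epsilon>"
  shows "interleaved K \<epsilon> M N \<longleftrightarrow> interleaved K \<epsilon> M' N'"
proof -
  have *: "interleaved K \<epsilon> Q R"
    if P: "interleaved K \<epsilon> Q' R'"
      and lin: "\<And>a. linear_map K (space_at Q a) (space_at Q' a) (\<theta> a)"
        "\<And>a. linear_map K (space_at Q' a) (space_at Q a) (\<eta> a)"
        "\<And>a. linear_map K (space_at R a) (space_at R' a) (\<mu> a)"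
        "\<And>a. linear_map K (space_at R' a) (space_at R a) (\<nu> a)"
      and inv: "\<And>a x. x \<in> carrier (space_at Q a) \<Longrightarrow> \<eta> a (\<theta> a x) = x"
        "\<And>a x. x \<in> carrier (space_at Q' a) \<Longrightarrow> \<theta> a (\<eta> a x) = x"
        "\<And>a x. x \<in> carrier (space_at R a) \<Longrightarrow> \<nu> a (\<mu> a x) = x"
        "\<And>a x. x \<in> carrier (space_at R' a) \<Longrightarrow> \<mu> a (\<nu> a x) = x"
      and nat: "\<And>a b x. a \<le> b \<Longrightarrow> x \<in> carrier (space_at Q a) \<Longrightarrow>
          \<theta> b (trans_map Q a b x) = trans_map Q' a b (\<theta> a x)"
        "\<And>a b x. a \<le> b \<Longrightarrow> x \<in> carrier (space_at Q' a) \<Longrightarrow>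
          \<eta> b (trans_map Q' a b x) = trans_map Q a b (\<eta> a x)"
        "\<And>a b x. a \<le> b \<Longrightarrow> x \<in> carrier (space_at R a) \<Longrightarrow>
          \<mu> b (trans_map R a b x) = trans_map R' a b (\<mu> a x)"
        "\<And>a b x. a \<le> b \<Longrightarrow> x \<in> carrier (space_at R' a) \<Longrightarrow>
          \<nu> b (trans_map R' a b x) = trans_map R a b (\<nu> a x)"
    for Q R and Q' R' and \<theta> \<eta> \<mu> \<nu>
  proof -
    obtain \<phi> \<psi> where
      L: "\<And>a. linear_map K (space_at Q' a) (space_at R' (a + \<epsilon>)) (\<phi> a)"
         "\<And>a. linear_map K (space_at R' a) (space_at Q' (a + \<epsilon>)) (\<psi> a)" and
      A: "\<And>a b x. a \<le> b \<Longrightarrow> x \<in> carrier (space_at Q' a) \<Longrightarrow>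
           \<phi> b (trans_map Q' a b x) = trans_map R' (a + \<epsilon>) (b + \<epsilon>) (\<phi> a x)"
         "\<And>a b x. a \<le> b \<Longrightarrow> x \<in> carrier (space_at R' a) \<Longrightarrow>
           \<psi> b (trans_map R' a b x) = trans_map Q' (a + \<epsilon>) (b + \<epsilon>) (\<psi> a x)" and
      B: "\<And>a x. x \<in> carrier (space_at Q' a) \<Longrightarrow> \<psi> (a + \<epsilon>) (\<phi> a x) = trans_map Q' a (a + 2 * \<epsilon>) x"
         "\<And>a x. x \<in> carrier (space_at R' a) \<Longrightarrow> \<phi> (a + \<epsilon>) (\<psi> a x) = trans_map R' a (a + 2 * \<epsilon>) x"
      using P unfolding interleaved_def
      apply (elim exE conjE)
      subgoal for \<phi> \<psi> by (rule that[of \<phi> \<psi>]) blast+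
      done
    note cl = linear_map_closed[OF lin(1)] linear_map_closed[OF lin(2)]
      linear_map_closed[OF lin(3)] linear_map_closed[OF lin(4)]
      linear_map_closed[OF L(1)] linear_map_closed[OF L(2)]
    have two: "a + \<epsilon> + \<epsilon> = a + 2 * \<epsilon>" for a by simp
    show ?thesis
      unfolding interleaved_def
    proof (rule exI[of _ "\<lambda>a x. \<nu> (a + \<epsilon>) (\<phi> a (\<theta> a x))"],
        rule exI[of _ "\<lambda>a x. \<eta> (a + \<epsilon>) (\<psi> a (\<mu> a x))"], intro conjI allI ballI impI)
      show "linear_map K (space_at Q a) (space_at R (a + \<epsilon>)) (\<lambda>x. \<nu> (a + \<epsilon>) (\<phi> a (\<theta> a x)))" for a
        by (intro linear_map_compose[OF linear_map_compose[OF lin(1) L(1)] lin(4)])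
      show "linear_map K (space_at R a) (space_at Q (a + \<epsilon>)) (\<lambda>x. \<eta> (a + \<epsilon>) (\<psi> a (\<mu> a x)))" for a
        by (intro linear_map_compose[OF linear_map_compose[OF lin(3) L(2)] lin(2)])
    next
      fix a b :: real and x assume ab: "a \<le> b" and x: "x \<in> carrier (space_at Q a)"
      show "\<nu> (b + \<epsilon>) (\<phi> b (\<theta> b (trans_map Q a b x)))
        = trans_map R (a + \<epsilon>) (b + \<epsilon>) (\<nu> (a + \<epsilon>) (\<phi> a (\<theta> a x)))"
        using ab x by (simp add: nat A cl)
    next
      fix a b :: real and x assume ab: "a \<le> b" and x: "x \<in> carrier (space_at R a)"
      show "\<eta> (b + \<epsilon>) (\<psi> b (\<mu> b (trans_map R a b x)))
        = trans_map Q (a + \<epsilon>) (b + \<epsilon>) (\<eta> (a + \<epsilon>) (\<psi> a (\<mu> a x)))"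
        using ab x by (simp add: nat A cl)
    next
      fix a and x assume x: "x \<in> carrier (space_at Q a)"
      have "\<eta> (a + 2 * \<epsilon>) (trans_map Q' a (a + 2 * \<epsilon>) (\<theta> a x)) = trans_map Q a (a + 2 * \<epsilon>) x"
        using x e by (simp add: nat cl inv)
      then show "\<eta> (a + \<epsilon> + \<epsilon>) (\<psi> (a + \<epsilon>) (\<mu> (a + \<epsilon>) (\<nu> (a + \<epsilon>) (\<phi> a (\<theta> a x)))))
        = trans_map Q a (a + 2 * \<epsilon>) x"
        using x by (simp add: inv cl B two)
    next
      fix a and x assume x: "x \<in> carrier (space_at R a)"
      have "\<nu> (a + 2 * \<epsilon>) (trans_map R' a (a + 2 * \<epsilon>) (\<mu> a x)) = trans_map R a (a + 2 * \<epsilon>) x"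
        using x e by (simp add: nat cl inv)
      then show "\<nu> (a + \<epsilon> + \<epsilon>) (\<phi> (a + \<epsilon>) (\<theta> (a + \<epsilon>) (\<eta> (a + \<epsilon>) (\<psi> a (\<mu> a x)))))
        = trans_map R a (a + 2 * \<epsilon>) x"
        using x by (simp add: inv cl B two)
    qed
  qed
  obtain \<theta> \<eta> where 1:
    "\<And>a. linear_map K (space_at M a) (space_at M' a) (\<theta> a)"
    "\<And>a. linear_map K (space_at M' a) (space_at M a) (\<eta> a)"
    "\<And>a x. x \<in> carrier (space_at M a) \<Longrightarrow> \<eta> a (\<theta> a x) = x"
    "\<And>a y. y \<in> carrier (space_at M' a) \<Longrightarrow> \<theta> a (\<eta> a y) = y"
    "\<And>a b x. a \<le> b \<Longrightarrow> x \<in> carrier (space_at M a) \<Longrightarrow>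
       \<theta> b (trans_map M a b x) = trans_map M' a b (\<theta> a x)"
    "\<And>a b y. a \<le> b \<Longrightarrow> y \<in> carrier (space_at M' a) \<Longrightarrow>
       \<eta> b (trans_map M' a b y) = trans_map M a b (\<eta> a y)"
    using pmod_isoE[OF M] by blast
  obtain \<mu> \<nu> where 2:
    "\<And>a. linear_map K (space_at N a) (space_at N' a) (\<mu> a)"
    "\<And>a. linear_map K (space_at N' a) (space_at N a) (\<nu> a)"
    "\<And>a x. x \<in> carrier (space_at N a) \<Longrightarrow> \<nu> a (\<mu> a x) = x"
    "\<And>a y. y \<in> carrier (space_at N' a) \<Longrightarrow> \<mu> a (\<nu> a y) = y"
    "\<And>a b x. a \<le> b \<Longrightarrow> x \<in> carrier (space_at N a) \<Longrightarrow>
       \<mu> b (trans_map N a b x) = trans_map N' a b (\<mu> a x)"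
    "\<And>a b y. a \<le> b \<Longrightarrow> y \<in> carrier (space_at N' a) \<Longrightarrow>
       \<nu> b (trans_map N' a b y) = trans_map N a b (\<nu> a y)"
    using pmod_isoE[OF N] by blast
  show ?thesis
  proof
    assume "interleaved K \<epsilon> M' N'"
    then show "interleaved K \<epsilon> M N"
      by (rule *[OF _ 1(1,2) 2(1,2) 1(3,4) 2(3,4) 1(5,6) 2(5,6)])
  next
    assume "interleaved K \<epsilon> M N"
    then show "interleaved K \<epsilon> M' N'"
      by (rule *[OF _ 1(2,1) 2(2,1) 1(4,3) 2(4,3) 1(6,5) 2(6,5)])
  qed
qed

lemma iso_class_refl:
  assumes "persistence_module K M"
  shows "M \<in> iso_class K M"
  unfolding iso_class_def pmod_iso_def
  using assms
  by (auto intro!: exI[of _ "\<lambda>a x. x"] simp: linear_map_iff module_hom_def persistence_moduleD(1)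
      bij_betw_def)

lemma class_dist_iso_class:
  assumes "persistence_module K M" "persistence_module K N"
  shows "class_dist K (iso_class K M) (iso_class K N) = interleaving_dist K M N"
proof -
  have "interleaving_dist K M' N' = interleaving_dist K M N"
    if "M' \<in> iso_class K M" "N' \<in> iso_class K N" for M' N'
  proof -
    have "interleaved K \<epsilon> M N \<longleftrightarrow> interleaved K \<epsilon> M' N'" if "0 \<le> \<epsilon>" for \<epsilon>
      using \<open>M' \<in> _\<close> \<open>N' \<in> _\<close> assms that by (intro interleaved_pmod_iso) (auto simp: iso_class_def)
    then have "{\<epsilon>. 0 \<le> \<epsilon> \<and> interleaved K \<epsilon> M' N'} = {\<epsilon>. 0 \<le> \<epsilon> \<and> interleaved K \<epsilon> M N}" by auto
    then show ?thesis by (simp add: interleaving_dist_def)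
  qed
  moreover have "iso_class K M \<noteq> {}" "iso_class K N \<noteq> {}"
    using assms iso_class_refl by blast+
  ultimately show ?thesis by (simp add: class_dist_def)
qed

end

theory Submission
  imports Defs
begin

text \<open>One sequence defeats all four spaces. Let \<open>t\<close> be the midpoint of \<open>[c, d]\<close>, let \<open>l\<close> be a sequence of
  positive radii that decreases to \<open>0\<close>, and let \<open>M n\<close> be the direct sum of the interval modules on
  \<open>(t - l i, t + l i)\<close> for \<open>i < n\<close>. All of these lie in (ffid) on \<open>[c, d]\<close>, the smallest of the four
  sets.

  The sequence is Cauchy: for \<open>k \<le> m \<le> n\<close>, the summands of \<open>M n\<close> missing from \<open>M m\<close> live on intervals of
  length at most \<open>2 * l k\<close>, so they are killed by a shift by \<open>2 * l k\<close> and the two modules are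
  \<open>l k\<close>-interleaved (\<open>interleaved_nested_sum\<close>).

  There is no limit \<open>N\<close> in (pfd), the largest of the four sets: all intervals share the centre \<open>t\<close>, so
  an \<open>\<epsilon>\<close>-interleaving of \<open>M n\<close> with \<open>N\<close>, where \<open>n \<ge> k\<close> and \<open>\<epsilon> < l k\<close>, factors the transition map of
  \<open>M n\<close> from \<open>t - \<epsilon>\<close> to \<open>t + \<epsilon>\<close> through \<open>N(t)\<close>. This map is the identity on the first \<open>k\<close> summands, which
  forces \<open>N(t)\<close> to have dimension at least \<open>k\<close> (\<open>interleaved_interval_sum_le_dim\<close>). If \<open>M n\<close> converged to
  \<open>N\<close>, this would hold for every \<open>k\<close> (\<open>nested_sum_no_pfd_limit\<close>).

  As (fid) is contained in (pfd) (\<open>fin_dim_interval_sum\<close>), the same argument applies to every set between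
  (ffid) on \<open>[c, d]\<close> and (pfd). Classes consist of modules with vectors in the type \<open>'v\<close>, so the sums
  \<open>M n\<close>, whose vectors are functions, are first copied to \<open>'v\<close> along an injection (\<open>transport_pmod\<close>).\<close>

section \<open>Linear maps and dimension\<close>

lemma vectorspace_iff: "vectorspace K V \<longleftrightarrow> module K V \<and> field K"
  by (auto simp: vectorspace_def)

lemma linear_mapI:
  assumes "vectorspace K V" "vectorspace K W"
    and "\<And>x. x \<in> carrier V \<Longrightarrow> f x \<in> carrier W"
    and "\<And>x y. x \<in> carrier V \<Longrightarrow> y \<in> carrier V \<Longrightarrow> f (x \<oplus>\<^bsub>V\<^esub> y) = f x \<oplus>\<^bsub>W\<^esub> f y"
    and "\<And>r x. r \<in> carrier K \<Longrightarrow> x \<in> carrier V \<Longrightarrow> f (r \<odot>\<^bsub>V\<^esub> x) = r \<odot>\<^bsub>W\<^esub> f x"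
  shows "linear_map K V W f"
  using assms by (auto simp: linear_map_iff module_hom_def)

lemma linear_mapD:
  assumes "linear_map K V W f"
  shows "vectorspace K V" "vectorspace K W"
    and "x \<in> carrier V \<Longrightarrow> f x \<in> carrier W"
    and "x \<in> carrier V \<Longrightarrow> y \<in> carrier V \<Longrightarrow> f (x \<oplus>\<^bsub>V\<^esub> y) = f x \<oplus>\<^bsub>W\<^esub> f y"
    and "r \<in> carrier K \<Longrightarrow> x \<in> carrier V \<Longrightarrow> f (r \<odot>\<^bsub>V\<^esub> x) = r \<odot>\<^bsub>W\<^esub> f x"
    and "f \<zero>\<^bsub>V\<^esub> = \<zero>\<^bsub>W\<^esub>"
proof -
  interpret linear_map K V W f by fact
  show "f \<zero>\<^bsub>V\<^esub> = \<zero>\<^bsub>W\<^esub>" by simp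
qed (use assms in \<open>auto simp: linear_map_iff module_hom_def\<close>)

lemma vectorspace_zero_closed: "vectorspace K V \<Longrightarrow> \<zero>\<^bsub>V\<^esub> \<in> carrier V"
  by (simp add: vectorspace_def module_def abelian_group_def abelian_monoid.zero_closed)

lemma linear_map_zero:
  assumes "vectorspace K V" "vectorspace K W"
  shows "linear_map K V W (\<lambda>x. \<zero>\<^bsub>W\<^esub>)"
proof -
  interpret W: vectorspace K W by fact
  show ?thesis using assms by (intro linear_mapI) auto
qed

text \<open>A family with a dual family of functionals is linearly independent: the functional \<open>h i\<close> reads off
  the \<open>i\<close>-th coefficient of a linear combination. In this form a factorisation of an identity map
  through \<open>W\<close> bounds the dimension of \<open>W\<close> from below.\<close>

lemma dual_family_le_dim:
  assumes W: "vectorspace K W" and fd: "vectorspace.fin_dim K W" and I: "finite I"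
    and v: "\<And>i. i \<in> I \<Longrightarrow> v i \<in> carrier W"
    and h: "\<And>i. i \<in> I \<Longrightarrow> linear_map K W (line_space K) (h i)"
    and dual: "\<And>i j. i \<in> I \<Longrightarrow> j \<in> I \<Longrightarrow> h i (v j) = (if i = j then \<one>\<^bsub>K\<^esub> else \<zero>\<^bsub>K\<^esub>)"
  shows "card I \<le> vectorspace.dim K W"
proof -
  interpret W: vectorspace K W by fact
  have inj: "inj_on v I"
  proof
    fix i j assume ij: "i \<in> I" "j \<in> I" "v i = v j"
    then have "(if i = j then \<one>\<^bsub>K\<^esub> else \<zero>\<^bsub>K\<^esub>) = \<one>\<^bsub>K\<^esub>"
      using dual[of i j] dual[of i i] by auto
    then show "i = j" using W.zero_not_one by (auto split: if_splits)
  qed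
  have "W.module.lin_indpt (v ` I)"
  proof (rule W.module.finite_lin_indpt2)
    fix a assume a: "a \<in> v ` I \<rightarrow> carrier K" and 0: "W.module.lincomb a (v ` I) = \<zero>\<^bsub>W\<^esub>"
    show "\<forall>w\<in>v ` I. a w = \<zero>\<^bsub>K\<^esub>"
    proof safe
      fix i assume i: "i \<in> I"
      interpret h: linear_map K W "line_space K" "h i" by (rule h[OF i])
      have "(\<Oplus>\<^bsub>W\<^esub>w\<in>v ` I. a w \<odot>\<^bsub>W\<^esub> w) = \<zero>\<^bsub>W\<^esub>"
        using 0 by (simp add: W.module.lincomb_def)
      moreover have "h i (\<Oplus>\<^bsub>W\<^esub>w\<in>v ` I. a w \<odot>\<^bsub>W\<^esub> w)
          = (\<Oplus>\<^bsub>line_space K\<^esub>w\<in>v ` I. h i (a w \<odot>\<^bsub>W\<^esub> w))"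
        using a v I by (subst h.hom_sum) auto
      moreover have "\<dots> = (\<Oplus>\<^bsub>line_space K\<^esub>w\<in>v ` I. if v i = w then a w else \<zero>\<^bsub>line_space K\<^esub>)"
        using a v i dual inj
        by (intro h.W.module.M.finsum_cong')
          (auto simp: line_space_def linear_mapD(5)[OF h[OF i]] inj_on_eq_iff Pi_iff)
      moreover have "\<dots> = a (v i)"
        using a i I by (subst h.W.module.M.finsum_singleton[of "v i" _ a, simplified])
          (auto simp: line_space_def)
      ultimately show "a (v i) = \<zero>\<^bsub>K\<^esub>"
        using linear_mapD(6)[OF h[OF i]] by (simp add: line_space_def)
    qed
  qed (use v I in auto)
  then have "card (v ` I) \<le> W.dim"
    using v by (intro W.li_le_dim(2)[OF fd]) auto
  then show ?thesis by (simp add: card_image inj)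
qed

section \<open>Finite direct sums\<close>

lemma dsum_space_sel [simp]:
  "carrier (dsum_space I V) = (\<Pi>\<^sub>E i\<in>I. carrier (V i))"
  "\<zero>\<^bsub>dsum_space I V\<^esub> = (\<lambda>i\<in>I. \<zero>\<^bsub>V i\<^esub>)"
  "f \<oplus>\<^bsub>dsum_space I V\<^esub> g = (\<lambda>i\<in>I. f i \<oplus>\<^bsub>V i\<^esub> g i)"
  "c \<odot>\<^bsub>dsum_space I V\<^esub> f = (\<lambda>i\<in>I. c \<odot>\<^bsub>V i\<^esub> f i)"
  by (simp_all add: dsum_space_def)

lemma vectorspace_dsum_space:
  assumes "field K" and V: "\<And>i. i \<in> I \<Longrightarrow> vectorspace K (V i)"
  shows "vectorspace K (dsum_space I V)"
proof -
  have M: "module K (V i)" if "i \<in> I" for i using V[OF that] by (simp add: vectorspace_iff)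
  have G: "abelian_group (V i)" if "i \<in> I" for i using M[OF that] by (rule module.axioms)
  have Mo: "abelian_monoid (V i)" if "i \<in> I" for i using G[OF that] by (rule abelian_group.axioms)
  have cring: "cring K" using assms(1) by (simp add: field_def domain_def)
  note [simp] = abelian_monoid.zero_closed[OF Mo] abelian_monoid.a_closed[OF Mo]
    module.smult_closed[OF M] abelian_monoid.r_zero[OF Mo]
  have "module K (dsum_space I V)"
  proof (rule module_criteria[OF cring]; (intro ballI allI impI)?; (elim conjE)?)
    fix v assume v: "v \<in> carrier (dsum_space I V)"
    show "\<exists>w\<in>carrier (dsum_space I V). v \<oplus>\<^bsub>dsum_space I V\<^esub> w = \<zero>\<^bsub>dsum_space I V\<^esub>"
    proof -
      have vi: "v i \<in> carrier (V i)" if "i \<in> I" for i using v that by auto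
      show ?thesis
        by (intro bexI[of _ "\<lambda>i\<in>I. \<ominus>\<^bsub>V i\<^esub> v i"])
          (auto simp: abelian_group.r_neg[OF G vi] abelian_group.a_inv_closed[OF G vi]
            intro!: restrict_ext)
    qed
    show "v \<oplus>\<^bsub>dsum_space I V\<^esub> \<zero>\<^bsub>dsum_space I V\<^esub> = v"
      using v by (auto simp: fun_eq_iff PiE_iff extensional_def restrict_def)
    show "\<one>\<^bsub>K\<^esub> \<odot>\<^bsub>dsum_space I V\<^esub> v = v"
      using v by (auto simp: fun_eq_iff PiE_iff extensional_def restrict_def module.smult_one[OF M])
  qed (auto simp: PiE_iff abelian_monoid.a_comm[OF Mo] abelian_monoid.a_lcomm[OF Mo]
      abelian_monoid.a_assoc[OF Mo]
      module.smult_assoc1[OF M] module.smult_l_distr[OF M] module.smult_r_distr[OF M]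
      intro!: restrict_ext)
  then show ?thesis using assms(1) by (simp add: vectorspace_iff)
qed

lemma linear_map_dsum_component:
  assumes "field K" "\<And>i. i \<in> I \<Longrightarrow> vectorspace K (V i)" "i \<in> I"
  shows "linear_map K (dsum_space I V) (V i) (\<lambda>f. f i)"
  using assms by (intro linear_mapI vectorspace_dsum_space) auto

text \<open>The universal property of the product. It reduces linearity of the transition maps and of the
  interleaving maps of a direct sum to linearity of their components.\<close>

lemma linear_map_into_dsum:
  assumes "vectorspace K U" "\<And>i. i \<in> I \<Longrightarrow> linear_map K U (V i) (f i)"
  shows "linear_map K U (dsum_space I V) (\<lambda>x. \<lambda>i\<in>I. f i x)"
proof -
  have K: "field K" using assms(1) by (simp add: vectorspace_iff)
  show ?thesis
    by (intro linear_mapI vectorspace_dsum_space K assms(1) linear_mapD(2)[OF assms(2)])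
      (auto simp: linear_mapD(3-5)[OF assms(2)] intro!: restrict_ext)
qed

definition dsum_inj :: "'i set \<Rightarrow> ('i \<Rightarrow> ('k, 'v) module) \<Rightarrow> 'i \<Rightarrow> 'v \<Rightarrow> 'i \<Rightarrow> 'v" where
  "dsum_inj I V j x = (\<lambda>i\<in>I. if i = j then x else \<zero>\<^bsub>V i\<^esub>)"

lemma dsum_inj_closed:
  assumes "\<And>i. i \<in> I \<Longrightarrow> vectorspace K (V i)" "x \<in> carrier (V j)"
  shows "dsum_inj I V j x \<in> carrier (dsum_space I V)"
  using assms(2) vectorspace_zero_closed[OF assms(1)] by (auto simp: dsum_inj_def)

text \<open>Cyclic summands suffice here: at each point an interval module is either a line or zero. The proof
  splits off one coordinate of a family after the other, by induction on the set of indices where the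
  family may be nonzero.\<close>

lemma fin_dim_dsum_space:
  assumes K: "field K" and I: "finite I" and V: "\<And>i. i \<in> I \<Longrightarrow> vectorspace K (V i)"
    and u: "\<And>i. i \<in> I \<Longrightarrow> u i \<in> carrier (V i)"
    and gen: "\<And>i x. i \<in> I \<Longrightarrow> x \<in> carrier (V i) \<Longrightarrow> \<exists>r\<in>carrier K. x = r \<odot>\<^bsub>V i\<^esub> u i"
  shows "vectorspace.fin_dim K (dsum_space I V)"
proof -
  let ?D = "dsum_space I V"
  interpret D: vectorspace K ?D by (rule vectorspace_dsum_space[OF K V])
  define E where "E = (\<lambda>i. dsum_inj I V i (u i)) ` I"
  have E: "E \<subseteq> carrier ?D"
    unfolding E_def by (rule image_subsetI, rule dsum_inj_closed[where K = K]) (auto intro: V u)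
  have sub: "submodule K (D.module.span E) ?D"
    by (rule D.module.span_is_submodule[OF E])
  have M: "module K (V i)" if "i \<in> I" for i using V[OF that] by (simp add: vectorspace_iff)
  have Mo: "abelian_monoid (V i)" if "i \<in> I" for i
    using M[OF that] by (intro abelian_group.axioms module.axioms(2))
  have "f \<in> D.module.span E"
    if "finite J" "J \<subseteq> I" "f \<in> carrier ?D" "\<And>i. i \<in> I - J \<Longrightarrow> f i = \<zero>\<^bsub>V i\<^esub>" for J f
    using that
  proof (induction J arbitrary: f)
    case empty
    then have "f = \<zero>\<^bsub>?D\<^esub>" by (auto simp: fun_eq_iff PiE_iff extensional_def restrict_def)
    then show ?case using D.span_zero[of E] by (simp only:)
  next
    case (insert j J)
    then have j: "j \<in> I" and f: "\<And>i. i \<in> I \<Longrightarrow> f i \<in> carrier (V i)" by auto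
    obtain r where r: "r \<in> carrier K" "f j = r \<odot>\<^bsub>V j\<^esub> u j" using gen[OF j f[OF j]] by blast
    \<comment> \<open>\<open>f\<close> is \<open>r\<close> times the \<open>j\<close>-th generator plus \<open>g\<close>, and \<open>g\<close> is supported on \<open>J\<close>.\<close>
    define g where "g = f(j := \<zero>\<^bsub>V j\<^esub>)"
    have g: "g \<in> D.module.span E"
      using insert.prems j vectorspace_zero_closed[OF V[OF j]]
      by (intro insert.IH) (auto simp: g_def PiE_iff extensional_def)
    have "dsum_inj I V j (u j) \<in> D.module.span E"
      using D.span_mem[OF E, of "dsum_inj I V j (u j)"] j by (simp add: E_def)
    then have "r \<odot>\<^bsub>?D\<^esub> dsum_inj I V j (u j) \<in> D.module.span E"
      by (rule submodule.smult_closed[OF sub r(1)])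
    moreover have "f = r \<odot>\<^bsub>?D\<^esub> dsum_inj I V j (u j) \<oplus>\<^bsub>?D\<^esub> g"
      using insert.prems(2) f r
      by (auto simp: fun_eq_iff PiE_iff extensional_def restrict_def g_def dsum_inj_def
          module.smult_r_null[OF M] module.smult_closed[OF M] u
          abelian_monoid.l_zero[OF Mo] abelian_monoid.r_zero[OF Mo])
    ultimately show ?case using D.span_add1[OF E _ g] by (simp only:)
  qed
  from this[OF I] have "carrier ?D \<subseteq> D.module.span E" by blast
  then have "D.module.gen_set E" using D.span_closed[OF E] by blast
  then show ?thesis using E I by (auto simp: D.fin_dim_def E_def)
qed

lemma persistence_module_pmod_dsum:
  assumes K: "field K" and M: "\<And>i. i \<in> I \<Longrightarrow> persistence_module K (M i)"
  shows "persistence_module K (pmod_dsum I M)"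
proof -
  have V: "vectorspace K (space_at (M i) a)" if "i \<in> I" for i a
    using M[OF that] by (rule persistence_moduleD)
  have S: "vectorspace K (dsum_space I (\<lambda>i. space_at (M i) a))" for a
    by (rule vectorspace_dsum_space[OF K V])
  have L: "linear_map K (dsum_space I (\<lambda>i. space_at (M i) a)) (dsum_space I (\<lambda>i. space_at (M i) b))
      (\<lambda>f. \<lambda>i\<in>I. trans_map (M i) a b (f i))" if "a \<le> b" for a b
    by (rule linear_map_into_dsum[OF S], rule linear_map_compose,
        rule linear_map_dsum_component[OF K V], assumption+,
        rule persistence_moduleD(2)[OF M that])
  show ?thesis
    unfolding persistence_module_def pmod_dsum_def pmod.simps
    using S L
    by (auto simp: persistence_moduleD[OF M] PiE_iff extensional_def fun_eq_iff restrict_def)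
qed

section \<open>Interval modules\<close>

lemma vectorspace_line_space: "field K \<Longrightarrow> vectorspace K (line_space K)"
proof -
  assume K: "field K"
  interpret field K by fact
  have "module K (line_space K)"
    by (rule module_criteria)
      (auto simp: line_space_def a_ac m_ac l_distr r_distr cring_axioms
        intro!: bexI[of _ "\<ominus>\<^bsub>K\<^esub> _"] r_neg)
  then show ?thesis by (simp add: vectorspace_iff K)
qed

lemma vectorspace_zero_space: "field K \<Longrightarrow> vectorspace K (zero_space K)"
proof -
  assume K: "field K"
  interpret field K by fact
  have "module K (zero_space K)"
    by (rule module_criteria) (auto simp: zero_space_def line_space_def cring_axioms)
  then show ?thesis by (simp add: vectorspace_iff K)
qed

text \<open>Convexity of \<open>J\<close> is what makes the transition maps compose: a path between two points of \<open>J\<close> may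
  not pass through a zero space.\<close>

lemma persistence_module_interval_module:
  assumes K: "field K" and J: "is_interval J"
  shows "persistence_module K (interval_module K J)"
proof -
  interpret field K by fact
  have V: "vectorspace K (if a \<in> J then line_space K else zero_space K)" for a :: real
    by (simp add: vectorspace_line_space vectorspace_zero_space K)
  have conv: "b \<in> J" if "a \<in> J" "c \<in> J" "a \<le> b" "b \<le> c" for a b c
    using mem_is_interval_1_I[OF J that(1,2)] that(3,4) by simp
  show ?thesis
    unfolding persistence_module_def interval_module_def pmod.simps
  proof (intro conjI allI impI ballI)
    show "vectorspace K (if a \<in> J then line_space K else zero_space K)" for a by (rule V)
  next
    fix a b :: real
    show "linear_map K (if a \<in> J then line_space K else zero_space K)
        (if b \<in> J then line_space K else zero_space K) (\<lambda>x. if a \<in> J \<and> b \<in> J then x else \<zero>\<^bsub>K\<^esub>)"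
      by (rule linear_mapI[OF V V]) (auto simp: zero_space_def line_space_def split: if_splits)
  next
    fix a :: real and x assume "x \<in> carrier (if a \<in> J then line_space K else zero_space K)"
    then show "(if a \<in> J \<and> a \<in> J then x else \<zero>\<^bsub>K\<^esub>) = x"
      by (simp add: zero_space_def line_space_def split: if_splits)
  next
    fix a b c :: real and x assume "a \<le> b" "b \<le> c"
    then show "(if b \<in> J \<and> c \<in> J then if a \<in> J \<and> b \<in> J then x else \<zero>\<^bsub>K\<^esub> else \<zero>\<^bsub>K\<^esub>) =
        (if a \<in> J \<and> c \<in> J then x else \<zero>\<^bsub>K\<^esub>)"
      using conv[of a c b] by auto
  qed
qed

lemma fin_dim_interval_sum:
  assumes K: "field K" and M: "interval_sum K P M"
  shows "vectorspace.fin_dim K (space_at M a)"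
proof -
  interpret field K by fact
  obtain n :: nat and J where "pmod_iso K M (pmod_dsum {..<n} (\<lambda>i. interval_module K (J i)))"
    using M unfolding interval_sum_def by blast
  then obtain \<theta> where \<theta>: "linear_map K (space_at M a)
        (space_at (pmod_dsum {..<n} (\<lambda>i. interval_module K (J i))) a) \<theta>"
      "bij_betw \<theta> (carrier (space_at M a))
        (carrier (space_at (pmod_dsum {..<n} (\<lambda>i. interval_module K (J i))) a))"
    unfolding pmod_iso_def by blast
  have "vectorspace.fin_dim K (space_at (pmod_dsum {..<n} (\<lambda>i. interval_module K (J i))) a)"
    unfolding pmod_dsum_def pmod.simps
    by (rule fin_dim_dsum_space[OF K, where u = "\<lambda>i. if a \<in> J i then \<one>\<^bsub>K\<^esub> else \<zero>\<^bsub>K\<^esub>"])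
      (auto simp: interval_module_def vectorspace_line_space vectorspace_zero_space K,
       auto simp: zero_space_def line_space_def)
  then show ?thesis
    using linear_map.surj_fin_dim[OF linear_map_inv_into[OF \<theta>]]
      bij_betw_imp_surj_on[OF bij_betw_inv_into[OF \<theta>(2)]] by blast
qed

section \<open>Realising a module on a given type of vectors\<close>

text \<open>The structure on the image of \<open>g\<close> that makes \<open>g\<close> a linear isomorphism when it is injective on the
  carrier.\<close>

definition transport_space :: "('w \<Rightarrow> 'v) \<Rightarrow> ('k, 'w) module \<Rightarrow> ('k, 'v) module" where
  "transport_space g V = (let h = inv_into (carrier V) g in
     \<lparr>carrier = g ` carrier V, mult = (\<lambda>x y. g \<zero>\<^bsub>V\<^esub>), one = g \<zero>\<^bsub>V\<^esub>,
      zero = g \<zero>\<^bsub>V\<^esub>, add = (\<lambda>x y. g (h x \<oplus>\<^bsub>V\<^esub> h y)), smult = (\<lambda>c x. g (c \<odot>\<^bsub>V\<^esub> h x))\<rparr>)"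

definition transport_pmod :: "('w \<Rightarrow> 'v) \<Rightarrow> ('k, 'w) pmod \<Rightarrow> ('k, 'v) pmod" where
  "transport_pmod g M =
     \<lparr>space_at = (\<lambda>a. transport_space g (space_at M a)),
      trans_map = (\<lambda>a b y. g (trans_map M a b (inv_into (carrier (space_at M a)) g y)))\<rparr>"

lemma linear_map_transport:
  assumes V: "vectorspace K V" and g: "inj_on g (carrier V)"
  shows "linear_map K V (transport_space g V) g"
proof -
  interpret V: vectorspace K V by fact
  let ?T = "transport_space g V"
  have T: "carrier ?T = g ` carrier V" "\<zero>\<^bsub>?T\<^esub> = g \<zero>\<^bsub>V\<^esub>"
    "x \<in> carrier V \<Longrightarrow> y \<in> carrier V \<Longrightarrow> g x \<oplus>\<^bsub>?T\<^esub> g y = g (x \<oplus>\<^bsub>V\<^esub> y)"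
    "x \<in> carrier V \<Longrightarrow> r \<odot>\<^bsub>?T\<^esub> g x = g (r \<odot>\<^bsub>V\<^esub> x)" for x y r
    using g by (auto simp: transport_space_def Let_def)
  have "module K ?T"
  proof (rule module_criteria)
    show "\<forall>v\<in>carrier ?T. \<exists>w\<in>carrier ?T. v \<oplus>\<^bsub>?T\<^esub> w = \<zero>\<^bsub>?T\<^esub>"
    proof
      fix v assume "v \<in> carrier ?T"
      then obtain x where x: "x \<in> carrier V" "v = g x" by (auto simp: T)
      then show "\<exists>w\<in>carrier ?T. v \<oplus>\<^bsub>?T\<^esub> w = \<zero>\<^bsub>?T\<^esub>"
        by (intro bexI[of _ "g (\<ominus>\<^bsub>V\<^esub> x)"]) (auto simp: T V.module.M.r_neg)
    qed
  qed (auto simp: T V.module.M.a_ac V.module.smult_assoc1 V.module.smult_l_distr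
      V.module.smult_r_distr V.R.cring_axioms)
  then show ?thesis
    using V by (intro linear_mapI) (auto simp: T vectorspace_iff)
qed

lemma transport_pmod:
  assumes M: "persistence_module K M" and g: "\<And>a. inj_on g (carrier (space_at M a))"
  shows "persistence_module K (transport_pmod g M)" "pmod_iso K (transport_pmod g M) M"
proof -
  let ?V = "\<lambda>a. space_at M a" and ?h = "\<lambda>a. inv_into (carrier (space_at M a)) g"
  have gL: "linear_map K (?V a) (transport_space g (?V a)) g" for a
    by (rule linear_map_transport[OF persistence_moduleD(1)[OF M] g])
  have cT: "carrier (transport_space g (?V a)) = g ` carrier (?V a)" for a
    by (simp add: transport_space_def Let_def)
  have bij: "bij_betw g (carrier (?V a)) (carrier (transport_space g (?V a)))" for a
    using g by (simp add: bij_betw_def cT)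
  have hL: "linear_map K (transport_space g (?V a)) (?V a) (?h a)" for a
    by (rule linear_map_inv_into[OF gL bij])
  have hg: "?h a (g x) = x" if "x \<in> carrier (?V a)" for a x using g that by simp
  have L: "linear_map K (transport_space g (?V a)) (transport_space g (?V b))
      (\<lambda>y. g (trans_map M a b (?h a y)))" if "a \<le> b" for a b
    by (rule linear_map_compose[OF linear_map_compose[OF hL persistence_moduleD(2)[OF M that]] gL])
  show "persistence_module K (transport_pmod g M)"
    unfolding persistence_module_def transport_pmod_def pmod.simps
    using L linear_mapD(2)[OF gL] by (auto simp: cT hg persistence_moduleD[OF M])
  show "pmod_iso K (transport_pmod g M) M"
    unfolding pmod_iso_def transport_pmod_def pmod.simps
    using hL bij_betw_inv_into[OF bij]
    by (intro exI[of _ ?h]) (auto simp: cT hg persistence_moduleD[OF M])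
qed

section \<open>Interleavings of direct sums\<close>

lemma interleaved_sym: "interleaved K \<epsilon> M N \<Longrightarrow> interleaved K \<epsilon> N M"
  unfolding interleaved_def by blast

text \<open>Summands on which every transition map over a distance \<open>2 * \<epsilon>\<close> vanishes can be dropped at cost \<open>\<epsilon>\<close>:
  extension by zero and restriction, both combined with a shift by \<open>\<epsilon>\<close>, are inverse to each other up to
  a shift by \<open>2 * \<epsilon>\<close>.\<close>

lemma interleaved_pmod_dsum:
  assumes K: "field K" and M: "\<And>i. i \<in> I' \<Longrightarrow> persistence_module K (M i)" and I: "I \<subseteq> I'"
    and e: "0 \<le> \<epsilon>"
    and short: "\<And>i a x. i \<in> I' - I \<Longrightarrow> x \<in> carrier (space_at (M i) a) \<Longrightarrow>
      trans_map (M i) a (a + 2 * \<epsilon>) x = \<zero>\<^bsub>space_at (M i) (a + 2 * \<epsilon>)\<^esub>"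
  shows "interleaved K \<epsilon> (pmod_dsum I M) (pmod_dsum I' M)"
proof -
  define \<phi> where "\<phi> a f = (\<lambda>i\<in>I'. if i \<in> I then trans_map (M i) a (a + \<epsilon>) (f i)
      else \<zero>\<^bsub>space_at (M i) (a + \<epsilon>)\<^esub>)" for a f
  define \<psi> where "\<psi> a f = (\<lambda>i\<in>I. trans_map (M i) a (a + \<epsilon>) (f i))" for a f
  have V: "vectorspace K (space_at (M i) a)" if "i \<in> I'" for i a
    using M[OF that] by (rule persistence_moduleD)
  have V': "vectorspace K (space_at (M i) a)" if "i \<in> I" for i a
    using V I that by blast
  have S: "vectorspace K (dsum_space I' (\<lambda>i. space_at (M i) a))"
    "vectorspace K (dsum_space I (\<lambda>i. space_at (M i) a))" for a
    by (rule vectorspace_dsum_space[OF K V], assumption)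
      (rule vectorspace_dsum_space[OF K V'], assumption)
  have T: "linear_map K (space_at (M i) a) (space_at (M i) (a + \<epsilon>)) (trans_map (M i) a (a + \<epsilon>))"
    if "i \<in> I'" for i a using persistence_moduleD(2)[OF M[OF that]] e by simp
  have pr: "linear_map K (dsum_space I (\<lambda>i. space_at (M i) a)) (space_at (M i) a) (\<lambda>f. f i)"
    if "i \<in> I" for i a by (rule linear_map_dsum_component[OF K _ that]) (rule V')
  have pr': "linear_map K (dsum_space I' (\<lambda>i. space_at (M i) a)) (space_at (M i) a) (\<lambda>f. f i)"
    if "i \<in> I'" for i a by (rule linear_map_dsum_component[OF K _ that]) (rule V)
  have \<phi>: "linear_map K (dsum_space I (\<lambda>i. space_at (M i) a))
      (dsum_space I' (\<lambda>i. space_at (M i) (a + \<epsilon>))) (\<phi> a)" for a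
    unfolding \<phi>_def
  proof (rule linear_map_into_dsum[OF S(2)])
    fix i assume i: "i \<in> I'"
    show "linear_map K (dsum_space I (\<lambda>i. space_at (M i) a)) (space_at (M i) (a + \<epsilon>))
      (\<lambda>f. if i \<in> I then trans_map (M i) a (a + \<epsilon>) (f i) else \<zero>\<^bsub>space_at (M i) (a + \<epsilon>)\<^esub>)"
      using linear_map_compose[OF pr T[OF i]] linear_map_zero[OF S(2) V[OF i]]
      by (cases "i \<in> I") simp_all
  qed
  have \<psi>: "linear_map K (dsum_space I' (\<lambda>i. space_at (M i) a))
      (dsum_space I (\<lambda>i. space_at (M i) (a + \<epsilon>))) (\<psi> a)" for a
    unfolding \<psi>_def
    using I by (intro linear_map_into_dsum[OF S(1)] linear_map_compose[OF pr' T]) blast+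
  have z: "trans_map (M i) a b \<zero>\<^bsub>space_at (M i) a\<^esub> = \<zero>\<^bsub>space_at (M i) b\<^esub>"
    if "i \<in> I'" "a \<le> b" for i a b
    using linear_mapD(6)[OF persistence_moduleD(2)[OF M]] that by blast
  have two: "a + \<epsilon> + \<epsilon> = a + 2 * \<epsilon>" for a by simp
  show ?thesis
    unfolding interleaved_def pmod_dsum_def pmod.simps
  proof (rule exI[of _ \<phi>], rule exI[of _ \<psi>], intro conjI allI impI ballI)
  qed (use \<phi> \<psi> I e in \<open>auto simp: \<phi>_def \<psi>_def z short two PiE_iff persistence_moduleD[OF M]
      subset_iff intro!: restrict_ext\<close>)
qed

text \<open>The composite of the two interleaving maps around \<open>N(t)\<close> is the transition map of the sum from
  \<open>t - \<epsilon>\<close> to \<open>t + \<epsilon>\<close>. The unit vectors of the summands whose interval contains both points survive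
  it. Hence their images in \<open>N(t)\<close> have a dual family, given by the coordinates at \<open>t + \<epsilon>\<close>.\<close>

lemma interleaved_interval_sum_le_dim:
  assumes K: "field K" and N: "persistence_module K N"
    and fd: "vectorspace.fin_dim K (space_at N t)" and e: "0 \<le> \<epsilon>"
    and il: "interleaved K \<epsilon> (pmod_dsum I (\<lambda>i. interval_module K (J i))) N"
    and J: "\<And>i. i \<in> I \<Longrightarrow> is_interval (J i)" and I': "finite I'" "I' \<subseteq> I"
    and long: "\<And>i. i \<in> I' \<Longrightarrow> t - \<epsilon> \<in> J i \<and> t + \<epsilon> \<in> J i"
  shows "card I' \<le> vectorspace.dim K (space_at N t)"
proof -
  let ?D = "pmod_dsum I (\<lambda>i. interval_module K (J i))"
  let ?V = "\<lambda>a i. space_at (interval_module K (J i)) a"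
  interpret field K by fact
  obtain \<phi> \<psi> where \<phi>: "\<And>a. linear_map K (space_at ?D a) (space_at N (a + \<epsilon>)) (\<phi> a)"
    and \<psi>: "\<And>a. linear_map K (space_at N a) (space_at ?D (a + \<epsilon>)) (\<psi> a)"
    and \<psi>\<phi>: "\<And>a x. x \<in> carrier (space_at ?D a) \<Longrightarrow> \<psi> (a + \<epsilon>) (\<phi> a x) = trans_map ?D a (a + 2 * \<epsilon>) x"
    using il unfolding interleaved_def by blast
  have V: "vectorspace K (?V a i)" if "i \<in> I" for a i
    using persistence_module_interval_module[OF K J[OF that]] by (rule persistence_moduleD)
  define u where "u j = dsum_inj I (?V (t - \<epsilon>)) j \<one>\<^bsub>K\<^esub>" for j
  have u: "u j \<in> carrier (space_at ?D (t - \<epsilon>))" if "j \<in> I'" for j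
  proof -
    have "\<one>\<^bsub>K\<^esub> \<in> carrier (?V (t - \<epsilon>) j)"
      using long[OF that] by (simp add: interval_module_def line_space_def)
    then show ?thesis
      unfolding u_def pmod_dsum_def pmod.simps by (intro dsum_inj_closed[where K = K] V)
  qed
  have \<phi>t: "linear_map K (space_at ?D (t - \<epsilon>)) (space_at N t) (\<phi> (t - \<epsilon>))"
    using \<phi>[of "t - \<epsilon>"] by simp
  have pr: "linear_map K (space_at N t) (line_space K) (\<lambda>y. \<psi> t y i)" if "i \<in> I'" for i
  proof -
    have "linear_map K (space_at ?D (t + \<epsilon>)) (?V (t + \<epsilon>) i) (\<lambda>f. f i)"
      unfolding pmod_dsum_def pmod.simps using that I'
      by (intro linear_map_dsum_component[OF K V]) auto
    from linear_map_compose[OF \<psi> this] show ?thesis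
      using long[OF that] by (simp add: interval_module_def)
  qed
  show ?thesis
  proof (rule dual_family_le_dim[where v = "\<lambda>j. \<phi> (t - \<epsilon>) (u j)" and h = "\<lambda>i y. \<psi> t y i"])
    show "vectorspace K (space_at N t)" by (rule persistence_moduleD[OF N])
    fix i j assume ij: "i \<in> I'" "j \<in> I'"
    have "t - \<epsilon> + 2 * \<epsilon> = t + \<epsilon>" "t - \<epsilon> + \<epsilon> = t" by simp_all
    then have "\<psi> t (\<phi> (t - \<epsilon>) (u j)) = trans_map ?D (t - \<epsilon>) (t + \<epsilon>) (u j)"
      using \<psi>\<phi>[OF u[OF ij(2)]] by (simp only:)
    moreover have "trans_map ?D (t - \<epsilon>) (t + \<epsilon>) (u j) i = (if i = j then \<one>\<^bsub>K\<^esub> else \<zero>\<^bsub>K\<^esub>)"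
      using ij I' long[OF ij(1)]
      by (auto simp: pmod_dsum_def interval_module_def u_def dsum_inj_def zero_space_def line_space_def)
    ultimately show "\<psi> t (\<phi> (t - \<epsilon>) (u j)) i = (if i = j then \<one>\<^bsub>K\<^esub> else \<zero>\<^bsub>K\<^esub>)"
      by (simp only:)
  next
    fix i assume i: "i \<in> I'"
    show "\<phi> (t - \<epsilon>) (u i) \<in> carrier (space_at N t)" by (rule linear_mapD(3)[OF \<phi>t u[OF i]])
    show "linear_map K (space_at N t) (line_space K) (\<lambda>y. \<psi> t y i)" by (rule pr[OF i])
  qed (rule fd I'(1))+
qed

section \<open>A Cauchy sequence without a pointwise finite dimensional limit\<close>

definition nested_sum :: "('k, 'r) ring_scheme \<Rightarrow> real \<Rightarrow> (nat \<Rightarrow> real) \<Rightarrow> nat \<Rightarrow> ('k, nat \<Rightarrow> 'k) pmod"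
  where "nested_sum K t l n = pmod_dsum {..<n} (\<lambda>i. interval_module K {t - l i<..<t + l i})"

lemma persistence_module_nested_sum:
  "field K \<Longrightarrow> persistence_module K (nested_sum K t l n)"
  unfolding nested_sum_def
  by (intro persistence_module_pmod_dsum persistence_module_interval_module)
    (auto simp: is_interval_oo)

lemma interleaved_nested_sum:
  assumes K: "field K" and l: "antimono l" "0 \<le> l k" and k: "k \<le> m" "k \<le> n"
  shows "interleaved K (l k) (nested_sum K t l m) (nested_sum K t l n)"
proof -
  have *: "interleaved K (l k) (nested_sum K t l p) (nested_sum K t l q)" if "k \<le> p" "p \<le> q" for p q
    unfolding nested_sum_def
  proof (rule interleaved_pmod_dsum[OF K _ _ l(2)])
    fix i a x assume i: "i \<in> {..<q} - {..<p}"
    then have "l i \<le> l k" using antimonoD[OF l(1), of k i] that by simp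
    then show "trans_map (interval_module K {t - l i<..<t + l i}) a (a + 2 * l k) x =
        \<zero>\<^bsub>space_at (interval_module K {t - l i<..<t + l i}) (a + 2 * l k)\<^esub>"
      by (auto simp: interval_module_def zero_space_def line_space_def)
  qed (use that in \<open>auto intro!: persistence_module_interval_module K simp: is_interval_oo\<close>)
  show ?thesis
  proof (cases "m \<le> n")
    case True then show ?thesis using * k by simp
  next
    case False then show ?thesis using *[of n m] k interleaved_sym by simp
  qed
qed

text \<open>Were \<open>N\<close> a limit, a sum with at least \<open>dim N(t) + 1\<close> intervals would be interleaved with \<open>N\<close> at a
  scale below the first \<open>dim N(t) + 1\<close> radii, so \<open>N(t)\<close> would have to contain one independent vector
  too many.\<close>

lemma nested_sum_no_pfd_limit:
  assumes K: "field K" and l: "antimono l" "\<And>i. 0 < l i"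
    and N: "persistence_module K N" "vectorspace.fin_dim K (space_at N t)"
  shows "\<not> (\<lambda>n. interleaving_dist K (nested_sum K t l n) N) \<longlonglongrightarrow> 0"
proof
  assume lim: "(\<lambda>n. interleaving_dist K (nested_sum K t l n) N) \<longlonglongrightarrow> 0"
  define k where "k = Suc (vectorspace.dim K (space_at N t))"
  have "\<forall>\<^sub>F n in sequentially. interleaving_dist K (nested_sum K t l n) N < ennreal (l k)"
    using lim l(2)[of k] by (intro order_tendstoD) auto
  then obtain n where n: "interleaving_dist K (nested_sum K t l n) N < ennreal (l k)" "k \<le> n"
    unfolding eventually_sequentially by (meson nat_le_linear order_refl order_trans)
  from n(1) have "\<exists>\<epsilon>\<in>{\<epsilon>. 0 \<le> \<epsilon> \<and> interleaved K \<epsilon> (nested_sum K t l n) N}. ennreal \<epsilon> < ennreal (l k)"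
    unfolding interleaving_dist_def INF_less_iff .
  then obtain \<epsilon> where e: "0 \<le> \<epsilon>" "interleaved K \<epsilon> (nested_sum K t l n) N" "\<epsilon> < l k"
    by (auto simp: ennreal_less_iff)
  have "card {..<k} \<le> vectorspace.dim K (space_at N t)"
  proof (rule interleaved_interval_sum_le_dim[OF K N e(1) e(2)[unfolded nested_sum_def]])
    fix i assume "i \<in> {..<k}"
    then have "\<epsilon> < l i" using antimonoD[OF l(1), of i k] e(3) by simp
    then show "t - \<epsilon> \<in> {t - l i<..<t + l i} \<and> t + \<epsilon> \<in> {t - l i<..<t + l i}"
      using e(1) by auto
  qed (use n(2) in \<open>auto simp: is_interval_oo\<close>)
  then show False by (simp add: k_def)
qed

lemma interleaving_dist_pmod_iso:
  assumes "persistence_module K M" "persistence_module K M'" "pmod_iso K M M'"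
    and "persistence_module K N" "persistence_module K N'" "pmod_iso K N N'"
  shows "interleaving_dist K M N = interleaving_dist K M' N'"
proof -
  have "{\<epsilon>. 0 \<le> \<epsilon> \<and> interleaved K \<epsilon> M N} = {\<epsilon>. 0 \<le> \<epsilon> \<and> interleaved K \<epsilon> M' N'}"
    using interleaved_pmod_iso[OF assms] by blast
  then show ?thesis by (simp add: interleaving_dist_def)
qed

text \<open>Distances of classes are distances of representatives, and these do not change when the modules
  \<open>T n\<close> are replaced by the isomorphic nested sums.\<close>

lemma not_ext_complete_if_nested_sums:
  fixes X :: "('k, 'v) pmod set set" and T :: "nat \<Rightarrow> ('k, 'v) pmod"
  assumes K: "field K" and l: "antimono l" "\<And>i. 0 < l i" "l \<longlonglongrightarrow> 0"
    and T: "\<And>n. persistence_module K (T n)" "\<And>n. pmod_iso K (T n) (nested_sum K t l n)"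
    and X: "\<And>n. iso_class K (T n) \<in> X" "X \<subseteq> pfd K"
  shows "\<not> ext_complete X (class_dist K)"
proof
  assume complete: "ext_complete X (class_dist K)"
  note S = persistence_module_nested_sum[OF K]
  have cauchy: "ext_Cauchy (class_dist K) (\<lambda>n. iso_class K (T n))"
    unfolding ext_Cauchy_def
  proof (intro allI impI)
    fix e :: ennreal assume e: "e > 0"
    have "(\<lambda>k. ennreal (l k)) \<longlonglongrightarrow> ennreal 0"
      using l(3) by (rule tendsto_ennrealI)
    then have "\<forall>\<^sub>F k in sequentially. ennreal (l k) < e"
      using e by (intro order_tendstoD) auto
    then obtain k where k: "ennreal (l k) < e" unfolding eventually_sequentially by blast
    have "class_dist K (iso_class K (T m)) (iso_class K (T n)) < e" if "k \<le> m" "k \<le> n" for m n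
    proof -
      have "class_dist K (iso_class K (T m)) (iso_class K (T n))
          = interleaving_dist K (nested_sum K t l m) (nested_sum K t l n)"
        by (simp only: class_dist_iso_class[OF T(1) T(1)]
            interleaving_dist_pmod_iso[OF T(1) S T(2) T(1) S T(2)])
      also have "\<dots> \<le> ennreal (l k)"
        unfolding interleaving_dist_def
        using interleaved_nested_sum[OF K l(1) _ that] l(2)[of k]
        by (intro INF_lower) (simp add: less_imp_le)
      finally show ?thesis using k by simp
    qed
    then show "\<exists>N. \<forall>m\<ge>N. \<forall>n\<ge>N. class_dist K (iso_class K (T m)) (iso_class K (T n)) < e" by blast
  qed
  have "range (\<lambda>n. iso_class K (T n)) \<subseteq> X" using X(1) by (rule image_subsetI)
  from complete[unfolded ext_complete_def, rule_format, OF this cauchy]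
  obtain y where y: "y \<in> X" "(\<lambda>n. class_dist K (iso_class K (T n)) y) \<longlonglongrightarrow> 0" ..
  from X(2) y(1) have "y \<in> pfd K" ..
  then obtain N where N: "persistence_module K N" "y = iso_class K N"
      "vectorspace.fin_dim K (space_at N t)"
    unfolding pfd_def by blast
  have iso: "pmod_iso K N N" using iso_class_refl[OF N(1)] by (simp add: iso_class_def)
  have "class_dist K (iso_class K (T n)) y = interleaving_dist K (nested_sum K t l n) N" for n
    by (simp only: N(2) class_dist_iso_class[OF T(1) N(1)]
        interleaving_dist_pmod_iso[OF T(1) S T(2) N(1) N(1) iso])
  then show False using y(2) nested_sum_no_pfd_limit[OF K l(1,2) N(1,3)] by simp
qed

theorem theorem4p24:
  fixes K :: "('k, 'r) ring_scheme"
    and emb :: "'k list \<Rightarrow> 'v"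
    and c d :: real
  assumes "field K"
    and "inj_on emb (lists (carrier K))"
    and "c < d"
  shows "\<not> ext_complete (pfd K :: ('k, 'v) pmod set set) (class_dist K) \<and>
         \<not> ext_complete (fid K :: ('k, 'v) pmod set set) (class_dist K) \<and>
         \<not> ext_complete (ffid K :: ('k, 'v) pmod set set) (class_dist K) \<and>
         \<not> ext_complete (ffid_on K c d :: ('k, 'v) pmod set set) (class_dist K)"
proof -
  note K = assms(1)
  interpret field K by fact
  define t where "t = (c + d) / 2"
  define l where "l = (\<lambda>i. (d - c) / 2 * inverse (real (Suc i)))"
  have anti: "antimono l"
    using assms(3) by (auto simp: l_def intro!: antimonoI mult_left_mono le_imp_inverse_le)
  have pos: "0 < l i" for i using assms(3) by (simp add: l_def)
  have lim: "l \<longlonglongrightarrow> 0"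
    unfolding l_def by (rule tendsto_mult_right_zero[OF LIMSEQ_inverse_real_of_nat])
  have sub: "{t - l i<..<t + l i} \<subseteq> {c..d}" for i
  proof -
    have "l i \<le> l 0" using antimonoD[OF anti, of 0 i] by simp
    also have "l 0 = (d - c) / 2" by (simp add: l_def)
    finally have "c \<le> t - l i" "t + l i \<le> d" by (auto simp: t_def field_simps)
    then show ?thesis by auto
  qed
  \<comment> \<open>A vector of the \<open>n\<close>-th sum is determined by the list of its \<open>n\<close> coordinates, which \<open>emb\<close> encodes.\<close>
  define g where "g n f = emb (map f [0..<n])" for n and f :: "nat \<Rightarrow> 'k"
  define T :: "nat \<Rightarrow> ('k, 'v) pmod" where "T n = transport_pmod (g n) (nested_sum K t l n)" for n
  have "inj_on (g n) (carrier (space_at (nested_sum K t l n) a))" for n a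
  proof (rule inj_on_subset)
    show "inj_on (g n) ({..<n} \<rightarrow>\<^sub>E carrier K)"
    proof
      fix f f' assume f: "f \<in> {..<n} \<rightarrow>\<^sub>E carrier K" "f' \<in> {..<n} \<rightarrow>\<^sub>E carrier K" "g n f = g n f'"
      have "map f [0..<n] \<in> lists (carrier K)" "map f' [0..<n] \<in> lists (carrier K)"
        using f(1,2) by (auto simp: PiE_iff)
      with f(3) have "map f [0..<n] = map f' [0..<n]"
        unfolding g_def by (rule inj_onD[OF assms(2)])
      then have "f i = f' i" if "i \<in> {..<n}" for i using that by simp
      then show "f = f'" by (rule PiE_ext[OF f(1,2)])
    qed
    show "carrier (space_at (nested_sum K t l n) a) \<subseteq> {..<n} \<rightarrow>\<^sub>E carrier K"
      unfolding nested_sum_def pmod_dsum_def pmod.simps dsum_space_sel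
      by (rule PiE_mono) (simp add: interval_module_def zero_space_def line_space_def)
  qed
  note T = transport_pmod[OF persistence_module_nested_sum[OF K] this, folded T_def]
  have on: "iso_class K (T n) \<in> ffid_on K c d" for n
  proof -
    have "interval_sum K (\<lambda>J. bounded J \<and> J \<subseteq> {c..d}) (T n)"
      unfolding interval_sum_def
    proof (intro exI conjI)
      show "pmod_iso K (T n) (pmod_dsum {..<n} (\<lambda>i. interval_module K {t - l i<..<t + l i}))"
        using T(2) by (simp add: nested_sum_def)
    qed (use sub in \<open>simp add: is_interval_oo\<close>)
    then show ?thesis unfolding ffid_on_def using T(1) by blast
  qed
  have sub1: "(ffid_on K c d :: ('k, 'v) pmod set set) \<subseteq> ffid K"
    unfolding ffid_on_def ffid_def interval_sum_def by blast
  have sub2: "(ffid K :: ('k, 'v) pmod set set) \<subseteq> fid K"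
    unfolding ffid_def fid_def interval_sum_def by blast
  have sub3: "(fid K :: ('k, 'v) pmod set set) \<subseteq> pfd K"
    unfolding fid_def pfd_def using fin_dim_interval_sum[OF K] by blast
  have "\<not> ext_complete X (class_dist K)"
    if "ffid_on K c d \<subseteq> X" "X \<subseteq> pfd K" for X :: "('k, 'v) pmod set set"
    using not_ext_complete_if_nested_sums[OF K anti pos lim T] on that by blast
  then show ?thesis using sub1 sub2 sub3 by simp
qed

end
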